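(* Let $n\geqslant 1$ be an integer and let $N(\mathcal{PIO}_n^-)$ be the set of all nilpotent elements of the monoid $\mathcal{PIO}_n^-$. Then $$\lvert N(\mathcal{PIO}_{n}^{-})\rvert=2^{n+1}-\frac{(n+1)(n+2)}{2}.$$
   Context: $\Omega_n=\{1,\ldots,n\}$ with its natural order. A partial transformation of $\Omega_n$ is a map $\alpha$ from a subset $\operatorname{Dom}(\alpha)\subseteq\Omega_n$ (possibly empty) into $\Omega_n$, with image $\operatorname{Im}(\alpha)$. Maps are written on the right and composed from left to right: $x(\alpha\beta)=(x\alpha)\beta$, with $\operatorname{Dom}(\alpha\beta)=\{x\in\operatorname{Dom}(\alpha)\mid x\alpha\in\operatorname{Dom}(\beta)\}$. $\alpha$ is order-preserving if $x\leqslant y$ implies $x\alpha\leqslant y\alpha$ for all $x,y\in\operatorname{Dom}(\alpha)$, and order-decreasing if $x\alpha\leqslant x$ for all $x\in\operatorname{Dom}(\alpha)$. A subset $I\subseteq\Omega_n$ (possibly empty) is an interval if for all $x,y,z\in\Omega_n$, $x\leqslant y\leqslant z$ and $x,z\in I$ imply $y\in I$. $\mathcal{PIO}_n$ is the monoid, under composition, of all order-preserving partial transformations $\alpha$ of $\Omega_n$ such that $\operatorname{Dom}(\alpha)$ and $\operatorname{Im}(\alpha)$ are both intervals of $\Omega_n$, and $\mathcal{PIO}_n^-$ is its submonoid of order-decreasing elements. The zero of these monoids is the empty transformation $0_n$. An element $s$ of a semigroup with zero $0$ is nilpotent if $s^k=0$ for some positive integer $k$ (so $0$ itself is nilpotent).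 *)

theory Defs
  imports Complex_Main "HOL-Algebra.Group"
begin

definition Omega :: "nat \<Rightarrow> nat set" where
  "Omega n = {1..n}"

definition partial_transformation :: "nat \<Rightarrow> (nat \<rightharpoonup> nat) \<Rightarrow> bool" where
  "partial_transformation n \<alpha> \<longleftrightarrow> dom \<alpha> \<subseteq> Omega n \<and> ran \<alpha> \<subseteq> Omega n"

definition order_preserving :: "(nat \<rightharpoonup> nat) \<Rightarrow> bool" where
  "order_preserving \<alpha> \<longleftrightarrow>
    (\<forall>x \<in> dom \<alpha>. \<forall>y \<in> dom \<alpha>. x \<le> y \<longrightarrow> the (\<alpha> x) \<le> the (\<alpha> y))"

definition order_decreasing :: "(nat \<rightharpoonup> nat) \<Rightarrow> bool" where
  "order_decreasing \<alpha> \<longleftrightarrow> (\<forall>x \<in> dom \<alpha>. the (\<alpha> x) \<le> x)"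

definition interval_of :: "nat \<Rightarrow> nat set \<Rightarrow> bool" where
  "interval_of n I \<longleftrightarrow> I \<subseteq> Omega n \<and>
    (\<forall>x \<in> Omega n. \<forall>y \<in> Omega n. \<forall>z \<in> Omega n.
      x \<le> y \<and> y \<le> z \<and> x \<in> I \<and> z \<in> I \<longrightarrow> y \<in> I)"

text \<open>Maps act on the right and products are read from left to right, so the product
  of \<open>\<alpha>\<close> and \<open>\<beta>\<close> (first \<open>\<alpha>\<close>, then \<open>\<beta>\<close>) is \<open>\<beta> \<circ>\<^sub>m \<alpha>\<close>.\<close>

definition PIO :: "nat \<Rightarrow> (nat \<rightharpoonup> nat) monoid" where
  "PIO n = \<lparr>carrier = {\<alpha>. partial_transformation n \<alpha> \<and> order_preserving \<alpha> \<and>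
                           interval_of n (dom \<alpha>) \<and> interval_of n (ran \<alpha>)},
            mult = (\<lambda>\<alpha> \<beta>. \<beta> \<circ>\<^sub>m \<alpha>),
            one = Some |` Omega n\<rparr>"

definition PIO_dec :: "nat \<Rightarrow> (nat \<rightharpoonup> nat) monoid" where
  "PIO_dec n = (PIO n)\<lparr>carrier := {\<alpha> \<in> carrier (PIO n). order_decreasing \<alpha>}\<rparr>"

definition is_zero :: "('a, 'b) monoid_scheme \<Rightarrow> 'a \<Rightarrow> bool" where
  "is_zero G z \<longleftrightarrow> z \<in> carrier G \<and>
    (\<forall>x \<in> carrier G. z \<otimes>\<^bsub>G\<^esub> x = z \<and> x \<otimes>\<^bsub>G\<^esub> z = z)"

definition nilpotents :: "('a, 'b) monoid_scheme \<Rightarrow> 'a set" where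
  "nilpotents G =
    {s \<in> carrier G. \<exists>z. is_zero G z \<and> (\<exists>k::nat. k > 0 \<and> s [^]\<^bsub>G\<^esub> k = z)}"

lemma dom_product: "dom (\<beta> \<circ>\<^sub>m \<alpha>) = {x \<in> dom \<alpha>. the (\<alpha> x) \<in> dom \<beta>}"
  by (auto simp: map_comp_def split: option.splits)

lemma is_zero_unique: "is_zero G z \<Longrightarrow> is_zero G z' \<Longrightarrow> z = z'"
  unfolding is_zero_def by metis

lemma PIO_iff: "\<alpha> \<in> carrier (PIO n) \<longleftrightarrow>
   (\<forall>x y. \<alpha> x = Some y \<longrightarrow> x \<in> Omega n \<and> y \<in> Omega n) \<and>
   (\<forall>x y u v. \<alpha> x = Some u \<longrightarrow> \<alpha> y = Some v \<longrightarrow> x \<le> y \<longrightarrow> u \<le> v) \<and>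
   (\<forall>x y z u v. \<alpha> x = Some u \<longrightarrow> \<alpha> z = Some v \<longrightarrow> x \<le> y \<longrightarrow> y \<le> z \<longrightarrow> (\<exists>w. \<alpha> y = Some w)) \<and>
   (\<forall>x z u y v. \<alpha> x = Some u \<longrightarrow> \<alpha> z = Some v \<longrightarrow> u \<le> y \<longrightarrow> y \<le> v \<longrightarrow> (\<exists>w. \<alpha> w = Some y))"
  (is "_ \<longleftrightarrow> ?A \<and> ?B \<and> ?C \<and> ?D")
proof -
  have A: "partial_transformation n \<alpha> \<longleftrightarrow> ?A"
    by (auto simp: partial_transformation_def dom_def ran_def)
  have B: "order_preserving \<alpha> \<longleftrightarrow> ?B"
    unfolding order_preserving_def by (force simp: dom_def)
  have between: "y \<in> Omega n" if "x \<in> Omega n" "z \<in> Omega n" "x \<le> y" "y \<le> z" for x y z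
    using that by (auto simp: Omega_def)
  have C: "interval_of n (dom \<alpha>) \<longleftrightarrow> ?C" if ?A
  proof
    assume i: "interval_of n (dom \<alpha>)"
    show ?C
    proof (intro allI impI)
      fix x y z u v assume h: "\<alpha> x = Some u" "\<alpha> z = Some v" "x \<le> y" "y \<le> z"
      then have "x \<in> Omega n" "z \<in> Omega n" using that by blast+
      moreover from this have "y \<in> Omega n" using between h by blast
      moreover have "x \<in> dom \<alpha>" "z \<in> dom \<alpha>" using h by auto
      ultimately have "y \<in> dom \<alpha>" using i h unfolding interval_of_def by blast
      then show "\<exists>w. \<alpha> y = Some w" by auto
    qed
  next
    assume ?C
    moreover have "dom \<alpha> \<subseteq> Omega n" using that by auto
    ultimately show "interval_of n (dom \<alpha>)" unfolding interval_of_def dom_def by blast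
  qed
  have D: "interval_of n (ran \<alpha>) \<longleftrightarrow> ?D" if ?A
  proof
    assume i: "interval_of n (ran \<alpha>)"
    show ?D
    proof (intro allI impI)
      fix x z u y v assume h: "\<alpha> x = Some u" "\<alpha> z = Some v" "u \<le> y" "y \<le> v"
      then have "u \<in> Omega n" "v \<in> Omega n" using that by blast+
      moreover from this have "y \<in> Omega n" using between h by blast
      moreover have "u \<in> ran \<alpha>" "v \<in> ran \<alpha>" using h by (auto intro: ranI)
      ultimately have "y \<in> ran \<alpha>" using i h unfolding interval_of_def by blast
      then show "\<exists>w. \<alpha> w = Some y" by (auto simp: ran_def)
    qed
  next
    assume d: ?D
    have "ran \<alpha> \<subseteq> Omega n" using that by (auto simp: ran_def)
    then show "interval_of n (ran \<alpha>)" using d unfolding interval_of_def ran_def by blast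
  qed
  have "\<alpha> \<in> carrier (PIO n) \<longleftrightarrow> partial_transformation n \<alpha> \<and> order_preserving \<alpha> \<and>
      interval_of n (dom \<alpha>) \<and> interval_of n (ran \<alpha>)"
    by (simp add: PIO_def)
  then show ?thesis using A B C D by argo
qed

lemma PIO_closed:
  assumes "\<alpha> \<in> carrier (PIO n)" "\<beta> \<in> carrier (PIO n)"
  shows "\<beta> \<circ>\<^sub>m \<alpha> \<in> carrier (PIO n)"
proof -
  have a: "\<And>x y. \<alpha> x = Some y \<Longrightarrow> x \<in> Omega n \<and> y \<in> Omega n"
    "\<And>x y u v. \<alpha> x = Some u \<Longrightarrow> \<alpha> y = Some v \<Longrightarrow> x \<le> y \<Longrightarrow> u \<le> v"
    "\<And>x y z u v. \<alpha> x = Some u \<Longrightarrow> \<alpha> z = Some v \<Longrightarrow> x \<le> y \<Longrightarrow> y \<le> z \<Longrightarrow> \<exists>w. \<alpha> y = Some w"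
    "\<And>x z u y v. \<alpha> x = Some u \<Longrightarrow> \<alpha> z = Some v \<Longrightarrow> u \<le> y \<Longrightarrow> y \<le> v \<Longrightarrow> \<exists>w. \<alpha> w = Some y"
    using assms(1) unfolding PIO_iff by blast+
  have b: "\<And>x y. \<beta> x = Some y \<Longrightarrow> x \<in> Omega n \<and> y \<in> Omega n"
    "\<And>x y u v. \<beta> x = Some u \<Longrightarrow> \<beta> y = Some v \<Longrightarrow> x \<le> y \<Longrightarrow> u \<le> v"
    "\<And>x y z u v. \<beta> x = Some u \<Longrightarrow> \<beta> z = Some v \<Longrightarrow> x \<le> y \<Longrightarrow> y \<le> z \<Longrightarrow> \<exists>w. \<beta> y = Some w"
    "\<And>x z u y v. \<beta> x = Some u \<Longrightarrow> \<beta> z = Some v \<Longrightarrow> u \<le> y \<Longrightarrow> y \<le> v \<Longrightarrow> \<exists>w. \<beta> w = Some y"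
    using assms(2) unfolding PIO_iff by blast+
  have c: "(\<beta> \<circ>\<^sub>m \<alpha>) x = Some y \<longleftrightarrow> (\<exists>u. \<alpha> x = Some u \<and> \<beta> u = Some y)" for x y
    by (auto simp: map_comp_Some_iff)
  have 1: "\<exists>w u. \<alpha> y = Some u \<and> \<beta> u = Some w"
    if h: "\<alpha> x = Some p" "\<beta> p = Some u" "\<alpha> z = Some q" "\<beta> q = Some v" "x \<le> y" "y \<le> z"
    for x y z p q u v
  proof -
    obtain r where r: "\<alpha> y = Some r" using a(3)[OF h(1,3,5,6)] by blast
    then have "p \<le> r" "r \<le> q" using a(2)[OF h(1) r] a(2)[OF r h(3)] h(5,6) by auto
    then obtain w where "\<beta> r = Some w" using b(3)[OF h(2,4)] by blast
    then show ?thesis using r by blast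
  qed
  have 2: "\<exists>w r. \<alpha> w = Some r \<and> \<beta> r = Some y"
    if h: "\<alpha> x = Some p" "\<beta> p = Some u" "\<alpha> z = Some q" "\<beta> q = Some v" "u \<le> y" "y \<le> v"
    for x y z p q u v
  proof -
    obtain r where r: "\<beta> r = Some y" using b(4)[OF h(2,4-6)] by blast
    consider "r < p" | "p \<le> r" "r \<le> q" | "q < r" by linarith
    then show ?thesis
    proof cases
      case 1
      then have "y \<le> u" using b(2)[OF r h(2)] by simp
      then have "y = u" using h by simp
      then show ?thesis using h by blast
    next
      case 2
      then have "\<exists>w. \<alpha> w = Some r" using a(4)[OF h(1,3)] by blast
      then show ?thesis using r by blast
    next
      case 3
      then have "v \<le> y" using b(2)[OF h(4) r] by simp
      then have "y = v" using h by simp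
      then show ?thesis using h by blast
    qed
  qed
  show ?thesis unfolding PIO_iff c
  proof (intro conjI)
    show "\<forall>x y. (\<exists>u. \<alpha> x = Some u \<and> \<beta> u = Some y) \<longrightarrow> x \<in> Omega n \<and> y \<in> Omega n"
      using a(1) b(1) by blast
    show "\<forall>x y u v. (\<exists>p. \<alpha> x = Some p \<and> \<beta> p = Some u) \<longrightarrow>
        (\<exists>q. \<alpha> y = Some q \<and> \<beta> q = Some v) \<longrightarrow> x \<le> y \<longrightarrow> u \<le> v"
      using a(2) b(2) by blast
    show "\<forall>x y z u v. (\<exists>p. \<alpha> x = Some p \<and> \<beta> p = Some u) \<longrightarrow>
        (\<exists>q. \<alpha> z = Some q \<and> \<beta> q = Some v) \<longrightarrow> x \<le> y \<longrightarrow> y \<le> z \<longrightarrow>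
        (\<exists>w u. \<alpha> y = Some u \<and> \<beta> u = Some w)"
      using 1 by blast
    show "\<forall>x z u y v. (\<exists>p. \<alpha> x = Some p \<and> \<beta> p = Some u) \<longrightarrow>
        (\<exists>q. \<alpha> z = Some q \<and> \<beta> q = Some v) \<longrightarrow> u \<le> y \<longrightarrow> y \<le> v \<longrightarrow>
        (\<exists>w r. \<alpha> w = Some r \<and> \<beta> r = Some y)"
      using 2 by blast
  qed
qed

lemma map_comp_assoc: "(h \<circ>\<^sub>m g) \<circ>\<^sub>m f = h \<circ>\<^sub>m (g \<circ>\<^sub>m f)"
  by (rule ext) (simp add: map_comp_def split: option.split)

lemma PIO_one: "Some |` Omega n \<in> carrier (PIO n)"
proof -
  have r: "(Some |` Omega n) a = Some b \<longleftrightarrow> a \<in> Omega n \<and> b = a" for a b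
    by (auto simp: restrict_map_def)
  show ?thesis unfolding PIO_iff r by (auto simp: Omega_def)
qed

lemma PIO_mult: "x \<otimes>\<^bsub>PIO n\<^esub> y = y \<circ>\<^sub>m x"
  by (simp add: PIO_def)

lemma PIO_one_eq: "\<one>\<^bsub>PIO n\<^esub> = Some |` Omega n"
  by (simp add: PIO_def)

lemma PIO_monoid: "monoid (PIO n)"
proof (rule monoidI)
  fix x assume "x \<in> carrier (PIO n)"
  then have x: "a \<in> Omega n \<and> b \<in> Omega n" if "x a = Some b" for a b
    using that unfolding PIO_iff by blast
  have "(x \<circ>\<^sub>m (Some |` Omega n)) a = x a" "((Some |` Omega n) \<circ>\<^sub>m x) a = x a" for a
    using x[of a] by (cases "x a"; cases "a \<in> Omega n"; simp add: map_comp_def)+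
  then show "\<one>\<^bsub>PIO n\<^esub> \<otimes>\<^bsub>PIO n\<^esub> x = x" "x \<otimes>\<^bsub>PIO n\<^esub> \<one>\<^bsub>PIO n\<^esub> = x"
    by (simp_all add: PIO_mult PIO_one_eq fun_eq_iff)
qed (simp_all add: PIO_mult PIO_one_eq PIO_closed PIO_one map_comp_assoc)

lemma PIO_dec_submonoid: "submonoid (carrier (PIO_dec n)) (PIO n)"
proof (rule submonoid.intro)
  show "carrier (PIO_dec n) \<subseteq> carrier (PIO n)" by (auto simp: PIO_dec_def)
  show "\<one>\<^bsub>PIO n\<^esub> \<in> carrier (PIO_dec n)"
    using PIO_one by (simp add: PIO_dec_def PIO_one_eq order_decreasing_def)
  fix x y assume xy: "x \<in> carrier (PIO_dec n)" "y \<in> carrier (PIO_dec n)"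
  then have "x \<in> carrier (PIO n)" "y \<in> carrier (PIO n)"
    and le: "\<And>a b. x a = Some b \<Longrightarrow> b \<le> a" "\<And>a b. y a = Some b \<Longrightarrow> b \<le> a"
    by (auto simp: PIO_dec_def order_decreasing_def dom_def)
  then have "y \<circ>\<^sub>m x \<in> carrier (PIO n)" using PIO_closed by blast
  moreover have "order_decreasing (y \<circ>\<^sub>m x)"
    unfolding order_decreasing_def
  proof
    fix a assume "a \<in> dom (y \<circ>\<^sub>m x)"
    then obtain b c where "x a = Some b" "y b = Some c" by (auto simp: map_comp_Some_iff)
    then show "the ((y \<circ>\<^sub>m x) a) \<le> a" using le(1)[of a b] le(2)[of b c] by simp
  qed
  ultimately show "x \<otimes>\<^bsub>PIO n\<^esub> y \<in> carrier (PIO_dec n)"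
    by (simp add: PIO_dec_def PIO_mult)
qed

lemma PIO_dec_monoid: "monoid (PIO_dec n)"
  using submonoid.submonoid_is_monoid[OF PIO_dec_submonoid PIO_monoid, of n]
  by (simp add: PIO_dec_def)

lemma PIO_is_zero: "is_zero (PIO n) Map.empty"
proof -
  have "Map.empty \<in> carrier (PIO n)" unfolding PIO_iff by simp
  moreover have "x \<circ>\<^sub>m Map.empty = Map.empty" "Map.empty \<circ>\<^sub>m x = Map.empty" for x :: "nat \<rightharpoonup> nat"
    by (simp_all add: map_comp_def fun_eq_iff split: option.split)
  ultimately show ?thesis by (simp add: is_zero_def PIO_mult)
qed

lemma PIO_dec_is_zero: "is_zero (PIO_dec n) Map.empty"
proof -
  have "carrier (PIO_dec n) \<subseteq> carrier (PIO n)" "mult (PIO_dec n) = mult (PIO n)"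
    by (auto simp: PIO_dec_def)
  moreover have "Map.empty \<in> carrier (PIO_dec n)"
    using PIO_is_zero[of n] by (simp add: PIO_dec_def is_zero_def order_decreasing_def)
  ultimately show ?thesis
    using PIO_is_zero[of n] unfolding is_zero_def by (metis subsetD)
qed

lemma nilpotents_PIO_dec:
  "nilpotents (PIO_dec n) =
    {s \<in> carrier (PIO_dec n). \<exists>k::nat. k > 0 \<and> s [^]\<^bsub>PIO_dec n\<^esub> k = Map.empty}"
proof -
  have "is_zero (PIO_dec n) z \<longleftrightarrow> z = Map.empty" for z
  proof
    show "z = Map.empty" if "is_zero (PIO_dec n) z"
      using that PIO_dec_is_zero by (rule is_zero_unique)
  qed (simp only: PIO_dec_is_zero)
  then show ?thesis by (simp add: nilpotents_def)
qed

end

theory Submission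
  imports Defs
begin

text \<open>An order-decreasing \<open>\<alpha>\<close> is nilpotent exactly when it has no fixed point: a fixed point
  survives in every power, and without one each application lowers a point by at least one, so that
  \<open>n + 1\<close> applications leave nothing (\<open>nilpotents_PIO_dec_iff\<close>).

  A non-empty element of \<open>PIO n\<close> is a staircase: because its domain is an interval \<open>{a..b}\<close> and its
  image has no gaps, for \<open>a \<le> x < b\<close> the point \<open>x + 1\<close> is mapped either to the same point as \<open>x\<close> or to its successor
  (\<open>PIO_unit_steps\<close>). So \<open>\<alpha>\<close> is determined by \<open>a\<close>, \<open>b\<close>, the value \<open>c\<close> at \<open>a\<close>, and the set \<open>A\<close> of
  those \<open>x\<close> with \<open>a < x \<le> b\<close> at which it steps up. The graph of \<open>\<alpha>\<close> rises no faster than the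
  diagonal, so the absence of fixed points amounts to \<open>c < a\<close>. This suggests recording \<open>\<alpha>\<close> as the
  set \<open>S = {c, a} \<union> A \<union> {b + 1}\<close>. The listed order is increasing, so \<open>S\<close> gives back \<open>c\<close> as its least
  element, \<open>a\<close> as the second one, \<open>b + 1\<close> as the greatest and \<open>A\<close> as the rest; conversely, every
  subset of \<open>{1..n + 1}\<close> with at least three elements arises. Let the empty set stand for the empty
  map. Then the nilpotent elements correspond to the subsets of \<open>{1..n + 1}\<close> that have neither
  exactly one nor exactly two elements, and there are
  \<open>2 ^ (n + 1) - (n + 1) - (n + 1 choose 2)\<close> of these.

  The correspondence is the function \<open>stairs\<close>, which sends \<open>S\<close> to \<open>\<alpha>\<close>; it is bijective by
  \<open>stairs_nilpotent\<close>, \<open>stairs_injective\<close> and \<open>stairs_surjective\<close>.\<close>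

section \<open>Nilpotent means fixed-point free\<close>

lemma PIO_dec_iff:
  "\<alpha> \<in> carrier (PIO_dec n) \<longleftrightarrow> \<alpha> \<in> carrier (PIO n) \<and> (\<forall>x y. \<alpha> x = Some y \<longrightarrow> y \<le> x)"
  by (auto simp: PIO_dec_def order_decreasing_def dom_def)

lemma PIO_dec_pow_0: "\<alpha> [^]\<^bsub>PIO_dec n\<^esub> (0::nat) = Some |` Omega n"
  by (simp add: nat_pow_def PIO_dec_def PIO_def)

lemma PIO_dec_pow_Suc:
  "\<alpha> [^]\<^bsub>PIO_dec n\<^esub> (Suc k) = \<alpha> \<circ>\<^sub>m (\<alpha> [^]\<^bsub>PIO_dec n\<^esub> k)"
  by (simp add: nat_pow_def PIO_dec_def PIO_def)

text \<open>The bound \<open>y + k \<le> x\<close> for \<open>y\<close> the image of \<open>x\<close> under the \<open>k\<close>-th power makes fixed-point free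
  elements nilpotent.\<close>

lemma nilpotents_PIO_dec_iff:
  "\<alpha> \<in> nilpotents (PIO_dec n) \<longleftrightarrow>
     \<alpha> \<in> carrier (PIO n) \<and> (\<forall>x y. \<alpha> x = Some y \<longrightarrow> y < x)"
proof
  assume "\<alpha> \<in> nilpotents (PIO_dec n)"
  then obtain k where dec: "\<alpha> \<in> carrier (PIO_dec n)"
    and k: "\<alpha> [^]\<^bsub>PIO_dec n\<^esub> (k::nat) = Map.empty"
    unfolding nilpotents_PIO_dec by blast
  have "y < x" if xy: "\<alpha> x = Some y" for x y
  proof (rule ccontr)
    assume "\<not> y < x"
    then have fixed: "\<alpha> x = Some x"
      using dec xy unfolding PIO_dec_iff by (metis le_neq_implies_less)
    then have "x \<in> Omega n" using dec unfolding PIO_dec_iff PIO_iff by blast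
    then have "(\<alpha> [^]\<^bsub>PIO_dec n\<^esub> (j::nat)) x = Some x" for j
      using fixed by (induction j)
        (simp_all add: PIO_dec_pow_0 PIO_dec_pow_Suc map_comp_def del: nat_pow_0 nat_pow_Suc)
    then show False using k by (metis option.distinct(1))
  qed
  then show "\<alpha> \<in> carrier (PIO n) \<and> (\<forall>x y. \<alpha> x = Some y \<longrightarrow> y < x)"
    using dec unfolding PIO_dec_iff by blast
next
  assume *: "\<alpha> \<in> carrier (PIO n) \<and> (\<forall>x y. \<alpha> x = Some y \<longrightarrow> y < x)"
  have drop: "x \<le> n \<and> y + k \<le> x"
    if "(\<alpha> [^]\<^bsub>PIO_dec n\<^esub> k) x = Some y" for k x y
    using that
  proof (induction k arbitrary: y)
    case 0
    then have "(Some |` Omega n) x = Some y" by (simp only: PIO_dec_pow_0)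
    then show ?case by (auto simp: restrict_map_def Omega_def split: if_splits)
  next
    case (Suc k)
    then obtain z where "(\<alpha> [^]\<^bsub>PIO_dec n\<^esub> k) x = Some z" "\<alpha> z = Some y"
      unfolding PIO_dec_pow_Suc map_comp_Some_iff by blast
    then show ?case using Suc.IH[of z] * by fastforce
  qed
  have "\<alpha> [^]\<^bsub>PIO_dec n\<^esub> (Suc n) = Map.empty"
  proof
    fix x
    show "(\<alpha> [^]\<^bsub>PIO_dec n\<^esub> (Suc n)) x = None"
      using drop[of "Suc n" x] by (cases "(\<alpha> [^]\<^bsub>PIO_dec n\<^esub> (Suc n)) x") fastforce+
  qed
  moreover have "\<alpha> \<in> carrier (PIO_dec n)"
    using * unfolding PIO_dec_iff by (meson less_imp_le)
  ultimately show "\<alpha> \<in> nilpotents (PIO_dec n)"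
    unfolding nilpotents_PIO_dec by blast
qed

section \<open>The staircase of a finite set\<close>

text \<open>For \<open>S = {c < a < \<dots> < b + 1}\<close>, the map with domain \<open>{a..b}\<close> that takes the value \<open>c\<close> at \<open>a\<close> and
  steps up at each later element of \<open>S\<close> below \<open>b + 1\<close>. Writing the height at \<open>x\<close> as the number of
  elements of \<open>S\<close> up to \<open>x\<close>, less the two elements \<open>c\<close> and \<open>a\<close>, avoids naming the second element
  \<open>a\<close>: the condition \<open>a \<le> x\<close> says that there are at least two such elements.\<close>

definition stairs :: "nat set \<Rightarrow> nat \<rightharpoonup> nat" where
  "stairs S = (\<lambda>x. if 2 \<le> card (S \<inter> {..x}) \<and> x < Max S
                   then Some (Min S + card (S \<inter> {..x}) - 2) else None)"

lemma stairs_empty [simp]: "stairs {} = Map.empty"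
  by (simp add: stairs_def fun_eq_iff)

lemma stairs_eq_Some_iff:
  "stairs S x = Some y \<longleftrightarrow>
     2 \<le> card (S \<inter> {..x}) \<and> x < Max S \<and> y = Min S + card (S \<inter> {..x}) - 2"
  by (auto simp: stairs_def)

lemma card_Int_atMost_mono: "x \<le> y \<Longrightarrow> card (S \<inter> {..x}) \<le> card (S \<inter> {..y})" for x y :: nat
  by (intro card_mono) auto

lemma card_Int_atMost_Suc:
  "card (S \<inter> {..Suc x}) = (if Suc x \<in> S then Suc (card (S \<inter> {..x})) else card (S \<inter> {..x}))"
proof -
  have "S \<inter> {..Suc x} = (if Suc x \<in> S then insert (Suc x) (S \<inter> {..x}) else S \<inter> {..x})"
    by (auto simp: le_Suc_eq)
  then show ?thesis by simp
qed

text \<open>This makes the image of a staircase an interval.\<close>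

lemma intermediate_value_unit_steps:
  fixes f :: "nat \<Rightarrow> nat"
  assumes "\<And>x. f (Suc x) \<le> Suc (f x)" "p \<le> q" "f p \<le> y" "y \<le> f q"
  shows "\<exists>w. p \<le> w \<and> w \<le> q \<and> f w = y"
  using assms(2,4)
proof (induction q rule: dec_induct)
  case base
  then show ?case using assms(3) by auto
next
  case (step q)
  then show ?case
    using assms(1)[of q] by (metis le_Suc_eq le_trans nle_le order_refl)
qed

text \<open>The elements of \<open>S\<close> up to \<open>x\<close> lie in \<open>{Min S..x}\<close>, so there are at most \<open>x - Min S + 1\<close> of
  them; hence the value at \<open>x\<close> is at most \<open>x - 1\<close>. A set with at most two elements gives the
  empty map.\<close>

lemma stairs_nilpotent:
  assumes "S \<subseteq> {1..n + 1}"
  shows "stairs S \<in> nilpotents (PIO_dec n)"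
proof -
  have fin: "finite S" using assms finite_subset by blast
  have bounds: "1 \<le> y \<and> y < x \<and> x \<le> n" if "stairs S x = Some y" for x y
  proof -
    have two: "2 \<le> card (S \<inter> {..x})" and top: "x < Max S"
      and y: "y = Min S + card (S \<inter> {..x}) - 2"
      using that by (auto simp: stairs_eq_Some_iff)
    have "S \<inter> {..x} \<noteq> {}" using two by (metis card.empty not_numeral_le_zero)
    then obtain s where s: "s \<in> S" "s \<le> x" by auto
    then have "S \<noteq> {}" by auto
    then have "Max S \<le> n + 1" "1 \<le> Min S" using assms fin by (auto dest: Max_in Min_in)
    moreover have "Min S \<le> x" using s Min_le[OF fin s(1)] by linarith
    moreover have "card (S \<inter> {..x}) \<le> card {Min S..x}" using fin by (intro card_mono) auto
    ultimately show ?thesis using two top y by auto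
  qed
  have mono: "u \<le> v" if "stairs S x = Some u" "stairs S z = Some v" "x \<le> z" for x z u v
    using that card_Int_atMost_mono[of x z S] by (auto simp: stairs_eq_Some_iff)
  have convex: "\<exists>w. stairs S y = Some w"
    if "stairs S x = Some u" "stairs S z = Some v" "x \<le> y" "y \<le> z" for x y z u v
    using that card_Int_atMost_mono[of x y S] by (auto simp: stairs_eq_Some_iff)
  have onto: "\<exists>w. stairs S w = Some y"
    if h: "stairs S x = Some u" "stairs S z = Some v" "u \<le> y" "y \<le> v" for x z u v y
  proof (cases "x \<le> z")
    case True
    \<comment> \<open>Outside its domain the staircase continues as a total function with steps of height at
      most one.\<close>
    let ?f = "\<lambda>w. Min S + card (S \<inter> {..w}) - 2"
    have "?f (Suc w) \<le> Suc (?f w)" for w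
      using card_Int_atMost_Suc[of S w] by (simp split: if_splits)
    moreover have "?f x \<le> y" "y \<le> ?f z" using h by (auto simp: stairs_eq_Some_iff)
    ultimately obtain w where w: "x \<le> w" "w \<le> z" "?f w = y"
      using intermediate_value_unit_steps[of ?f x z y] True by blast
    then have "stairs S w = Some y"
      using h card_Int_atMost_mono[of x w S] by (auto simp: stairs_eq_Some_iff)
    then show ?thesis ..
  next
    case False
    then have "v \<le> u" using mono[OF h(2,1)] by simp
    then have "y = u" using h by simp
    then show ?thesis using h by blast
  qed
  have "stairs S \<in> carrier (PIO n)"
    unfolding PIO_iff
  proof (intro conjI)
    show "\<forall>x y. stairs S x = Some y \<longrightarrow> x \<in> Omega n \<and> y \<in> Omega n"
      using bounds by (fastforce simp: Omega_def)
  qed (use mono convex onto in blast)+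
  then show ?thesis using bounds unfolding nilpotents_PIO_dec_iff by blast
qed

text \<open>The second element is the left end of the domain of the staircase; a third element places it
  strictly below the maximum, so that this domain is not empty.\<close>

lemma second_element:
  fixes S :: "nat set"
  assumes "finite S" "3 \<le> card S"
  obtains a where "Min S < a" "a < Max S" "S \<inter> {..a} = {Min S, a}"
    "\<And>x. 2 \<le> card (S \<inter> {..x}) \<longleftrightarrow> a \<le> x"
proof -
  let ?c = "Min S" let ?a = "Min (S - {?c})"
  have ne: "S \<noteq> {}" using assms by auto
  then have c: "?c \<in> S" "\<And>s. s \<in> S \<Longrightarrow> ?c \<le> s" using assms by auto
  have "card (S - {?c}) = card S - 1" using c by simp
  then have "card (S - {?c}) \<noteq> 0" using assms(2) by simp
  then have "S - {?c} \<noteq> {}" by (metis card.empty)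
  then have a: "?a \<in> S - {?c}" "\<And>s. s \<in> S - {?c} \<Longrightarrow> ?a \<le> s"
    using assms(1) Min_in[of "S - {?c}"] Min_le[of "S - {?c}"] by blast+
  have ca: "?c < ?a" using a(1) c(2)[of ?a] by auto
  have low: "S \<inter> {..?a} = {?c, ?a}" using a c ca by (auto simp del: Min_le intro: antisym)
  have "?a < Max S"
  proof (rule ccontr)
    assume "\<not> ?a < Max S"
    then have "S \<subseteq> {..?a}" using Max_ge[OF assms(1)] by (meson atMost_iff le_trans not_less subsetI)
    then have "S = {?c, ?a}" using low by blast
    then have "card S = card {?c, ?a}" by simp
    also have "\<dots> \<le> 2" by (simp add: card_insert_if)
    finally show False using assms(2) by simp
  qed
  moreover have "2 \<le> card (S \<inter> {..x}) \<longleftrightarrow> ?a \<le> x" for x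
  proof
    assume "2 \<le> card (S \<inter> {..x})"
    then have "\<not> S \<inter> {..x} \<subseteq> {?c}" using card_mono[of "{?c}" "S \<inter> {..x}"] by auto
    then obtain s where "s \<in> S - {?c}" "s \<le> x" by blast
    then show "?a \<le> x" using a(2) le_trans by blast
  next
    assume "?a \<le> x"
    then have "card (S \<inter> {..?a}) \<le> card (S \<inter> {..x})" by (rule card_Int_atMost_mono)
    then show "2 \<le> card (S \<inter> {..x})" using low ca by simp
  qed
  ultimately show thesis using that ca low by blast
qed

text \<open>Among the finite sets without exactly one or two elements, only the empty one gives the
  empty map. If \<open>S\<close> has at least three elements and \<open>a\<close> is the
  second of them, the domain of the staircase is \<open>{a..<Max S}\<close> and its value at \<open>a\<close> is \<open>Min S\<close>, so the staircase
  determines the three elements \<open>Min S\<close>, \<open>a\<close> and \<open>Max S\<close>. Each point between \<open>a\<close> and \<open>Max S\<close> is in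
  \<open>S\<close> if and only if the staircase steps up there.\<close>

lemma stairs_injective:
  assumes fin: "finite S" "finite T"
    and S: "card S \<notin> {1, 2}" and T: "card T \<notin> {1, 2}"
    and eq: "stairs S = stairs T"
  shows "S = T"
proof -
  have *: "\<exists>a. Min U < a \<and> a < Max U \<and> U \<inter> {..a} = {Min U, a} \<and>
      dom (stairs U) = {a..<Max U} \<and> stairs U a = Some (Min U)"
    if U: "finite U" "card U \<notin> {1, 2}" "U \<noteq> {}" for U
  proof -
    have "card U \<noteq> 0" using U by simp
    then have "3 \<le> card U" using U(2) by auto
    then obtain a where a: "Min U < a" "a < Max U" "U \<inter> {..a} = {Min U, a}"
      and two: "\<And>x. 2 \<le> card (U \<inter> {..x}) \<longleftrightarrow> a \<le> x"
      using second_element[OF U(1) \<open>3 \<le> card U\<close>] by blast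
    have "dom (stairs U) = {a..<Max U}"
      by (auto simp: stairs_def two dom_def)
    moreover have "stairs U a = Some (Min U)"
      using a by (simp add: stairs_eq_Some_iff)
    ultimately show ?thesis using a by blast
  qed
  show ?thesis
  proof (cases "S = {} \<or> T = {}")
    case True
    then have "dom (stairs S) = {}" "dom (stairs T) = {}" using eq by auto
    then show ?thesis using *[OF fin(1) S] *[OF fin(2) T] True by fastforce
  next
    case False
    obtain a where a: "Min S < a" "a < Max S" "S \<inter> {..a} = {Min S, a}"
      "dom (stairs S) = {a..<Max S}" "stairs S a = Some (Min S)"
      using *[OF fin(1) S] False by blast
    obtain b where b: "Min T < b" "b < Max T" "T \<inter> {..b} = {Min T, b}"
      "dom (stairs T) = {b..<Max T}" "stairs T b = Some (Min T)"
      using *[OF fin(2) T] False by blast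
    have "{a..<Max S} = {b..<Max T}" using a b eq by simp
    then have ab: "b = a" and M: "Max T = Max S"
      using a(2) b(2) by (simp_all add: atLeastLessThan_eq_iff)
    have c: "Min T = Min S" using a(5) b(5) eq ab by simp
    have cards: "card (S \<inter> {..x}) = card (T \<inter> {..x})" if x: "a \<le> x" "x < Max S" for x
    proof -
      have "x \<in> dom (stairs S)" using a(4) x by simp
      then obtain y where "stairs S x = Some y" "stairs T x = Some y" using eq by auto
      then show ?thesis using c by (auto simp: stairs_eq_Some_iff)
    qed
    have "x \<in> S \<longleftrightarrow> x \<in> T" for x
    proof -
      consider "x \<le> a" | "a < x" "x < Max S" | "Max S \<le> x" by linarith
      then show ?thesis
      proof cases
        case 1
        have "S \<inter> {..a} = T \<inter> {..a}" using a(3) b(3) ab c by simp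
        then show ?thesis using 1 by blast
      next
        case 2
        then obtain w where w: "x = Suc w" "a \<le> w" by (cases x) auto
        then show ?thesis
          using cards[of w] cards[of x] 2 by (auto simp: card_Int_atMost_Suc split: if_splits)
      next
        case 3
        have "x \<in> U \<longleftrightarrow> x = Max U" if "finite U" "U \<noteq> {}" "Max U \<le> x" for U
          using that by (metis Max_ge Max_in antisym)
        then show ?thesis using 3 fin False M by metis
      qed
    qed
    then show ?thesis by blast
  qed
qed

text \<open>If a step were higher, the image, being an interval, would contain a point strictly between
  the values at \<open>x\<close> and \<open>Suc x\<close>, which monotonicity forbids.\<close>

lemma PIO_unit_steps:
  assumes "\<alpha> \<in> carrier (PIO n)" "\<alpha> x = Some u" "\<alpha> (Suc x) = Some v"
  shows "v = u \<or> v = Suc u"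
proof (rule ccontr)
  have mono: "\<And>x y u v. \<alpha> x = Some u \<Longrightarrow> \<alpha> y = Some v \<Longrightarrow> x \<le> y \<Longrightarrow> u \<le> v"
    and onto: "\<And>x z u y v. \<alpha> x = Some u \<Longrightarrow> \<alpha> z = Some v \<Longrightarrow> u \<le> y \<Longrightarrow> y \<le> v \<Longrightarrow> \<exists>w. \<alpha> w = Some y"
    using assms(1) unfolding PIO_iff by blast+
  assume "\<not> (v = u \<or> v = Suc u)"
  then have v: "Suc u < v" using mono[OF assms(2,3)] by simp
  then obtain w where w: "\<alpha> w = Some (Suc u)" using onto[OF assms(2,3), of "Suc u"] by auto
  show False
  proof (cases "w \<le> x")
    case True
    then show False using mono[OF w assms(2)] by simp
  next
    case False
    then show False using mono[OF assms(3) w] v by simp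
  qed
qed

text \<open>Given \<open>\<alpha>\<close>, the set to take consists of the value at the left end of the domain, the left end
  itself, the points of ascent, and the successor of the right end. Since all steps have height at
  most one, counting ascents recovers the values of \<open>\<alpha>\<close>.\<close>

lemma stairs_surjective:
  assumes "\<alpha> \<in> nilpotents (PIO_dec n)"
  obtains S where "S \<subseteq> {1..n + 1}" "card S \<notin> {1, 2}" "\<alpha> = stairs S"
proof (cases "\<alpha> = Map.empty")
  case True
  then show thesis using that[of "{}"] by simp
next
  case False
  have PIO: "\<alpha> \<in> carrier (PIO n)" and less: "\<And>x y. \<alpha> x = Some y \<Longrightarrow> y < x"
    using assms unfolding nilpotents_PIO_dec_iff by blast+
  then have range: "\<And>x y. \<alpha> x = Some y \<Longrightarrow> 1 \<le> x \<and> x \<le> n \<and> 1 \<le> y"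
    and convex: "\<And>x y z u v. \<alpha> x = Some u \<Longrightarrow> \<alpha> z = Some v \<Longrightarrow> x \<le> y \<Longrightarrow> y \<le> z \<Longrightarrow> \<exists>w. \<alpha> y = Some w"
    unfolding PIO_iff Omega_def by (fastforce, blast)
  define a b where "a = Min (dom \<alpha>)" and "b = Max (dom \<alpha>)"
  have "dom \<alpha> \<subseteq> {1..n}" using range by fastforce
  then have fin: "finite (dom \<alpha>)" using finite_subset by blast
  have ne: "dom \<alpha> \<noteq> {}" using False by simp
  have mem: "a \<in> dom \<alpha>" "b \<in> dom \<alpha>" using fin ne by (simp_all add: a_def b_def)
  have dom: "dom \<alpha> = {a..b}"
  proof
    show "dom \<alpha> \<subseteq> {a..b}" using fin Min_le Max_ge unfolding a_def b_def
      by (meson atLeastAtMost_iff subsetI)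
    show "{a..b} \<subseteq> dom \<alpha>"
    proof
      fix x assume "x \<in> {a..b}"
      then show "x \<in> dom \<alpha>" using mem convex[of a _ b _ x] by auto
    qed
  qed
  have ab: "a \<le> b" using mem(1) dom by simp
  obtain c where c: "\<alpha> a = Some c" using mem by auto
  have order: "1 \<le> c" "c < a" "b \<le> n" using c less range mem by blast+
  define S where "S = {c, a, Suc b} \<union> {x \<in> {a<..b}. \<alpha> x \<noteq> \<alpha> (x - 1)}"
  have finS: "finite S" by (simp add: S_def)
  have sub: "S \<subseteq> {1..n + 1}" using order ab by (auto simp: S_def)
  have Min: "Min S = c" using finS order ab by (intro Min_eqI) (auto simp: S_def)
  have Max: "Max S = Suc b" using finS order ab by (intro Max_eqI) (auto simp: S_def)
  have "card {c, a, Suc b} \<le> card S" using finS by (intro card_mono) (auto simp: S_def)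
  then have card: "card S \<notin> {1, 2}" using order ab by auto
  have below: "card (S \<inter> {..x}) < 2" if "x < a" for x
  proof -
    have "S \<inter> {..x} \<subseteq> {c}" using that ab by (auto simp: S_def)
    then have "card (S \<inter> {..x}) \<le> card {c}" by (intro card_mono) auto
    then show ?thesis by simp
  qed
  have height: "2 \<le> card (S \<inter> {..x}) \<and> \<alpha> x = Some (c + card (S \<inter> {..x}) - 2)"
    if "a \<le> x" "x \<le> b" for x
    using that
  proof (induction x rule: dec_induct)
    case base
    have "S \<inter> {..a} = {c, a}" using order ab by (auto simp: S_def)
    then show ?case using order c by simp
  next
    case (step x)
    then have IH: "2 \<le> card (S \<inter> {..x})" "\<alpha> x = Some (c + card (S \<inter> {..x}) - 2)" by simp_all
    have "Suc x \<in> dom \<alpha>" using step dom by simp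
    then obtain v where v: "\<alpha> (Suc x) = Some v" by auto
    have "Suc x \<in> S \<longleftrightarrow> \<alpha> (Suc x) \<noteq> \<alpha> x" using step order by (auto simp: S_def)
    then show ?case
      using PIO_unit_steps[OF PIO IH(2) v] IH v by (auto simp: card_Int_atMost_Suc)
  qed
  have "\<alpha> x = stairs S x" for x
  proof -
    consider "x < a" | "a \<le> x" "x \<le> b" | "b < x" by linarith
    then show ?thesis
    proof cases
      case 1
      then have "x \<notin> dom \<alpha>" using dom by simp
      then show ?thesis using below[OF 1] by (simp add: stairs_def domIff)
    next
      case 2
      then show ?thesis using height[OF 2] by (simp add: stairs_def Min Max)
    next
      case 3
      then have "x \<notin> dom \<alpha>" using dom by simp
      then show ?thesis using 3 by (simp add: stairs_def domIff Max)
    qed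
  qed
  then show thesis using that sub card by blast
qed

section \<open>Counting\<close>

lemma card_subsets_size_not_1_2:
  assumes "finite A"
  shows "card {S. S \<subseteq> A \<and> card S \<notin> {1, 2}} + card A + (card A choose 2) = 2 ^ card A"
proof -
  let ?P = "\<lambda>k. {S. S \<subseteq> A \<and> card S = k}"
  let ?R = "{S. S \<subseteq> A \<and> card S \<notin> {1, 2}}"
  have fin: "finite X" if "X \<subseteq> Pow A" for X using assms that by (meson finite_Pow_iff finite_subset)
  have "Pow A = ?R \<union> (?P 1 \<union> ?P 2)" by auto
  then have "2 ^ card A = card (?R \<union> (?P 1 \<union> ?P 2))" using card_Pow[OF assms] by simp
  also have "\<dots> = card ?R + card (?P 1 \<union> ?P 2)"
    by (rule card_Un_disjoint) (auto intro: fin)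
  also have "card (?P 1 \<union> ?P 2) = card (?P 1) + card (?P 2)"
    by (rule card_Un_disjoint) (auto intro: fin)
  finally show ?thesis by (simp add: n_subsets[OF assms])
qed

theorem proposition14:
  fixes n :: nat
  assumes "n \<ge> 1"
  shows "real (card (nilpotents (PIO_dec n))) =
    2 ^ (n + 1) - (real n + 1) * (real n + 2) / 2"
proof -
  let ?T = "{S. S \<subseteq> {1..n + 1} \<and> card S \<notin> {1, 2}}"
  have "bij_betw stairs ?T (nilpotents (PIO_dec n))"
  proof (rule bij_betw_imageI)
    have fin: "finite S" if "S \<in> ?T" for S :: "nat set"
      using that finite_subset[of S "{1..n + 1}"] by blast
    show "inj_on stairs ?T"
    proof (rule inj_onI)
      fix S T
      assume "S \<in> ?T" "T \<in> ?T" "stairs S = stairs T"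
      then show "S = T" using stairs_injective[OF fin fin, of S T] by blast
    qed
    show "stairs ` ?T = nilpotents (PIO_dec n)"
      using stairs_nilpotent by (blast elim: stairs_surjective)
  qed
  then have "card (nilpotents (PIO_dec n)) = card ?T"
    by (simp add: bij_betw_same_card)
  then have "card (nilpotents (PIO_dec n)) + (n + 1) + (n + 1 choose 2) = 2 ^ (n + 1)"
    using card_subsets_size_not_1_2[of "{1..n + 1}"] by simp
  then have "real (card (nilpotents (PIO_dec n)) + (n + 1) + (n + 1 choose 2)) =
      real (2 ^ (n + 1))"
    by (simp only:)
  then have "real (card (nilpotents (PIO_dec n))) + (real n + 1) + real (n + 1 choose 2) =
      2 ^ (n + 1)"
    by (simp only: of_nat_add of_nat_power of_nat_1 of_nat_numeral)
  moreover have "real (n + 1 choose 2) = (real n + 1) * real n / 2"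
    by (simp add: choose_two real_of_nat_div algebra_simps)
  ultimately show ?thesis by (simp add: field_simps)
qed

end
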